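(* Let $f_\infty$ be in $\mathbb{H}_+$, $u=(u_m)_{m\ge0}$ a positive decreasing sequence, $K$ and $C$ positive numbers and $r$ a nonnegative integer. Assume that $(\Pi\mathbf{1}_k)_{k\ge0}$ is a sequence of linearly independent functions in $\mathbb{H}\cap L^1(\nu)$. Then for any positive integer $n$ and any integer $m\ge r$, $$\sup_{f\in\mathcal{C}_{f_\infty}(K,u,C,r)\cap\mathbb{H}_1}\mathbb{E}_f\|\widehat f_{m,n}-f\|_{\mathbb{H}}^2\ \le\ (Cu_m)^2+\frac{K}{n}\,\mathrm{tr}\big(R_m^{-1}\Delta_{f_\infty,m}\big).$$
   Context: $\mathcal{X}=\mathbb{Z}_+=\{0,1,2,\dots\}$, $\Theta$ is a Borel subset of $\mathbb{R}^d$, and $(\pi_\theta)_{\theta\in\Theta}$ is a family of probability mass functions on $\mathbb{Z}_+$, measurable in $\theta$. $\nu$ is a Radon measure on $\Theta$, $\mathbb{H}=L^2(\nu)$ (real) with scalar product $(f,g)_{\mathbb{H}}=\int fg\,d\nu$; $\mathbb{H}_+=\{f\in\mathbb{H}:f\ge0\}$, $\mathbb{H}_1=\{f\in\mathbb{H}_+:\int f\,d\nu=1\}$. For $k\ge0$, $\Pi\mathbf{1}_k$ is the function $\theta\mapsto\pi_\theta(k)$. $V_0=\{0\}$ and $V_m=\mathrm{Span}(\Pi\mathbf{1}_k,0\le k<m)$ for $m\ge1$; $\mathrm{Proj}_V$ is orthogonal projection onto $V$. For $f\in\mathbb{H}_1$, $\pi_f(k)=\int\pi_\theta(k)f(\theta)\nu(d\theta)$;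 $\mathbb{E}_f$ is expectation when the observations $X_1,\dots,X_n$ are i.i.d. from $\pi_f$. Projection estimator: with $P_n\mathbf{1}_k=\frac1n\#\{i\le n:X_i=k\}$, $\widehat f_{m,n}$ is the unique element of $V_m$ such that $(\widehat f_{m,n},\Pi\mathbf{1}_k)_{\mathbb{H}}=P_n\mathbf{1}_k$ for all $0\le k<m$. $\mathcal{C}(u,C,r)=\{f\in\mathbb{H}:\|f-\mathrm{Proj}_{V_m}f\|_{\mathbb{H}}\le Cu_m\text{ for all }m\ge r\}$; $\|f\|_{\infty,f_\infty}=\nu\text{-}\mathrm{ess\,sup}_\theta|f(\theta)|/f_\infty(\theta)$ (with $0/0=0$, $s/0=\infty$ for $s>0$); $\mathcal{C}_{f_\infty}(K,u,C,r)=\{f\in\mathcal{C}(u,C,r):\|f\|_{\infty,f_\infty}\le K\}$. $R_m$ is the $m\times m$ Gram matrix $[(\Pi\mathbf{1}_k,\Pi\mathbf{1}_l)_{\mathbb{H}}]_{0\le k,l<m}$ (symmetric positive definite under the independence assumption), and $\Delta_{f_\infty,m}$ is the $m\times m$ diagonal matrix with diagonal entries $(f_\infty,\Pi\mathbf{1}_k)_{\mathbb{H}}$, $0\le k<m$ (the trace being $0$ if $m=0$). *)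

theory Defs
  imports "HOL-Probability.Probability" "Jordan_Normal_Form.Gauss_Jordan_Elimination"
begin

definition radon_measure_on :: "'a::topological_space set \<Rightarrow> 'a measure \<Rightarrow> bool" where
  "radon_measure_on T \<nu> \<longleftrightarrow>
     sets \<nu> = sets (restrict_space borel T) \<and>
     (\<forall>x\<in>T. \<exists>U. open U \<and> x \<in> U \<and> emeasure \<nu> (U \<inter> T) < \<infinity>) \<and>
     (\<forall>B\<in>sets \<nu>. emeasure \<nu> B = (SUP L\<in>{L. compact L \<and> L \<subseteq> B}. emeasure \<nu> L))"

text \<open>
  Elements of \<open>L\<^sup>2(\<nu>)\<close> are represented by square-integrable functions, not by equivalence
  classes; pointwise conditions (nonnegativity, linear relations) are therefore stated
  \<open>\<nu>\<close>-almost everywhere.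
\<close>

definition L2 :: "'a measure \<Rightarrow> ('a \<Rightarrow> real) set" where
  "L2 \<nu> = {f \<in> borel_measurable \<nu>. integrable \<nu> (\<lambda>x. (f x)\<^sup>2)}"

definition L2_inner :: "'a measure \<Rightarrow> ('a \<Rightarrow> real) \<Rightarrow> ('a \<Rightarrow> real) \<Rightarrow> real" where
  "L2_inner \<nu> f g = (LINT x|\<nu>. f x * g x)"

definition L2_norm :: "'a measure \<Rightarrow> ('a \<Rightarrow> real) \<Rightarrow> real" where
  "L2_norm \<nu> f = sqrt (L2_inner \<nu> f f)"

definition L2_nonneg :: "'a measure \<Rightarrow> ('a \<Rightarrow> real) set" where
  "L2_nonneg \<nu> = {f \<in> L2 \<nu>. AE x in \<nu>. 0 \<le> f x}"

definition L2_densities :: "'a measure \<Rightarrow> ('a \<Rightarrow> real) set" where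
  "L2_densities \<nu> = {f \<in> L2_nonneg \<nu>. integrable \<nu> f \<and> (LINT x|\<nu>. f x) = 1}"

definition Pi1 :: "('a \<Rightarrow> nat pmf) \<Rightarrow> nat \<Rightarrow> 'a \<Rightarrow> real" where
  "Pi1 \<pi> k \<theta> = pmf (\<pi> \<theta>) k"

definition lin_indep_seq :: "'a measure \<Rightarrow> (nat \<Rightarrow> 'a \<Rightarrow> real) \<Rightarrow> bool" where
  "lin_indep_seq \<nu> \<phi> \<longleftrightarrow>
     (\<forall>m c. (AE x in \<nu>. (\<Sum>k<m. c k * \<phi> k x) = 0) \<longrightarrow> (\<forall>k<m. c k = (0::real)))"

text \<open>The linear span of \<open>\<Pi>1\<^sub>k\<close>, \<open>k < m\<close>; in particular it contains only the zero function for \<open>m = 0\<close>.\<close>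

definition V :: "('a \<Rightarrow> nat pmf) \<Rightarrow> nat \<Rightarrow> ('a \<Rightarrow> real) set" where
  "V \<pi> m = {g. \<exists>c::nat \<Rightarrow> real. g = (\<lambda>\<theta>. \<Sum>k<m. c k * Pi1 \<pi> k \<theta>)}"

text \<open>The orthogonal projection is unique only up to null sets, so a representative is chosen.\<close>

definition Proj :: "'a measure \<Rightarrow> ('a \<Rightarrow> real) set \<Rightarrow> ('a \<Rightarrow> real) \<Rightarrow> 'a \<Rightarrow> real" where
  "Proj \<nu> W f = (SOME g. g \<in> W \<and> (\<forall>h\<in>W. L2_inner \<nu> (\<lambda>x. f x - g x) h = 0))"

definition mixture :: "'a measure \<Rightarrow> ('a \<Rightarrow> nat pmf) \<Rightarrow> ('a \<Rightarrow> real) \<Rightarrow> nat \<Rightarrow> real" where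
  "mixture \<nu> \<pi> f k = (LINT \<theta>|\<nu>. pmf (\<pi> \<theta>) k * f \<theta>)"

text \<open>The joint law of \<open>X\<^sub>1, \<dots>, X\<^sub>n\<close>, i.i.d. with probability mass function \<open>\<pi>\<^sub>f\<close>.\<close>

definition sample_measure ::
  "'a measure \<Rightarrow> ('a \<Rightarrow> nat pmf) \<Rightarrow> ('a \<Rightarrow> real) \<Rightarrow> nat \<Rightarrow> (nat \<Rightarrow> nat) measure" where
  "sample_measure \<nu> \<pi> f n =
     PiM {1..n} (\<lambda>_. point_measure UNIV (\<lambda>k. ennreal (mixture \<nu> \<pi> f k)))"

definition empirical :: "nat \<Rightarrow> (nat \<Rightarrow> nat) \<Rightarrow> nat \<Rightarrow> real" where
  "empirical n X k = real (card {i \<in> {1..n}. X i = k}) / real n"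

definition proj_estimator ::
  "'a measure \<Rightarrow> ('a \<Rightarrow> nat pmf) \<Rightarrow> nat \<Rightarrow> nat \<Rightarrow> (nat \<Rightarrow> nat) \<Rightarrow> 'a \<Rightarrow> real" where
  "proj_estimator \<nu> \<pi> m n X =
     (THE g. g \<in> V \<pi> m \<and> (\<forall>k<m. L2_inner \<nu> g (Pi1 \<pi> k) = empirical n X k))"

text \<open>The expected squared error, as an extended real so that it is meaningful without an
  a priori integrability proof.\<close>

definition risk ::
  "'a measure \<Rightarrow> ('a \<Rightarrow> nat pmf) \<Rightarrow> nat \<Rightarrow> nat \<Rightarrow> ('a \<Rightarrow> real) \<Rightarrow> ennreal" where
  "risk \<nu> \<pi> m n f =
     (\<integral>\<^sup>+ X. ennreal ((L2_norm \<nu> (\<lambda>\<theta>. proj_estimator \<nu> \<pi> m n X \<theta> - f \<theta>))\<^sup>2)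
        \<partial>sample_measure \<nu> \<pi> f n)"

definition approx_class ::
  "'a measure \<Rightarrow> ('a \<Rightarrow> nat pmf) \<Rightarrow> (nat \<Rightarrow> real) \<Rightarrow> real \<Rightarrow> nat \<Rightarrow> ('a \<Rightarrow> real) set" where
  "approx_class \<nu> \<pi> u C r =
     {f \<in> L2 \<nu>. \<forall>m\<ge>r. L2_norm \<nu> (\<lambda>\<theta>. f \<theta> - Proj \<nu> (V \<pi> m) f \<theta>) \<le> C * u m}"

text \<open>Division on \<^typ>\<open>ennreal\<close> satisfies \<open>0 / 0 = 0\<close> and \<open>s / 0 = \<infinity>\<close> for \<open>s > 0\<close>.\<close>

definition weighted_sup_norm :: "'a measure \<Rightarrow> ('a \<Rightarrow> real) \<Rightarrow> ('a \<Rightarrow> real) \<Rightarrow> ennreal" where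
  "weighted_sup_norm \<nu> w f = esssup \<nu> (\<lambda>\<theta>. ennreal \<bar>f \<theta>\<bar> / ennreal (w \<theta>))"

definition bounded_approx_class ::
  "'a measure \<Rightarrow> ('a \<Rightarrow> nat pmf) \<Rightarrow> ('a \<Rightarrow> real) \<Rightarrow> real \<Rightarrow> (nat \<Rightarrow> real) \<Rightarrow> real \<Rightarrow> nat
     \<Rightarrow> ('a \<Rightarrow> real) set" where
  "bounded_approx_class \<nu> \<pi> w K u C r =
     {f \<in> approx_class \<nu> \<pi> u C r. weighted_sup_norm \<nu> w f \<le> ennreal K}"

definition gram_matrix :: "'a measure \<Rightarrow> ('a \<Rightarrow> nat pmf) \<Rightarrow> nat \<Rightarrow> real mat" where
  "gram_matrix \<nu> \<pi> m = Matrix.mat m m (\<lambda>(k, l). L2_inner \<nu> (Pi1 \<pi> k) (Pi1 \<pi> l))"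

definition Delta_matrix :: "'a measure \<Rightarrow> ('a \<Rightarrow> nat pmf) \<Rightarrow> ('a \<Rightarrow> real) \<Rightarrow> nat \<Rightarrow> real mat" where
  "Delta_matrix \<nu> \<pi> w m = mat_diag m (\<lambda>k. L2_inner \<nu> w (Pi1 \<pi> k))"

definition mat_trace :: "real mat \<Rightarrow> real" where
  "mat_trace A = sum_list (diag_mat A)"

end

theory Submission
  imports Defs "Jordan_Normal_Form.Determinant"
begin

text \<open>
  The columns of \<open>R\<^sub>m\<^sup>-\<^sup>1\<close> are the coefficients of the basis \<open>\<psi>\<^sub>j\<close> of \<open>V\<^sub>m\<close> dual to \<open>\<Pi>1\<^sub>k\<close>, so the
  estimator is \<open>\<Sum>\<^sub>j P\<^sub>n1\<^sub>j \<psi>\<^sub>j\<close> and the projection of \<open>f\<close> onto \<open>V\<^sub>m\<close> is \<open>\<Sum>\<^sub>j \<pi>\<^sub>f(j) \<psi>\<^sub>j\<close>. By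
  Pythagoras the risk is the squared bias plus the expected square norm of the difference of these
  two combinations. Since the Gram matrix of \<open>\<psi>\<close> is \<open>R\<^sub>m\<^sup>-\<^sup>1\<close>, the multinomial covariance of the
  \<open>P\<^sub>n1\<^sub>j\<close> evaluates the latter to \<open>1/n\<close> times \<open>\<Sum>\<^sub>j \<parallel>\<psi>\<^sub>j\<parallel>\<^sup>2 \<pi>\<^sub>f(j)\<close> minus the squared norm of the
  projection. Dropping the subtracted term and using \<open>f \<le> K f\<^sub>\<infinity>\<close> almost everywhere bounds it by the
  trace term.
\<close>

section \<open>Calculus of square-integrable functions and their inner product\<close>

lemma L2_integrable_mult:
  assumes "f \<in> L2 M" "g \<in> L2 M"
  shows "integrable M (\<lambda>x. f x * g x)"
proof (rule Bochner_Integration.integrable_bound)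
  show "integrable M (\<lambda>x. (f x)\<^sup>2 + (g x)\<^sup>2)"
    using assms by (auto simp: L2_def)
  have "\<bar>a * b\<bar> \<le> a\<^sup>2 + b\<^sup>2" for a b :: real
  proof -
    have "2 * \<bar>a * b\<bar> \<le> a\<^sup>2 + b\<^sup>2"
      using sum_squares_bound[of "\<bar>a\<bar>" "\<bar>b\<bar>"] by (simp add: abs_mult mult.assoc)
    then show ?thesis
      using abs_ge_zero[of "a * b"] by linarith
  qed
  then show "AE x in M. norm (f x * g x) \<le> norm ((f x)\<^sup>2 + (g x)\<^sup>2)"
    by simp
qed (use assms in \<open>auto simp: L2_def\<close>)

lemma L2_add:
  assumes "f \<in> L2 M" "g \<in> L2 M"
  shows "(\<lambda>x. f x + g x) \<in> L2 M"
  using assms L2_integrable_mult[OF assms] by (auto simp: L2_def power2_sum mult.assoc)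

lemma L2_mult_left:
  assumes "f \<in> L2 M"
  shows "(\<lambda>x. c * f x) \<in> L2 M"
  using assms by (auto simp: L2_def power_mult_distrib)

lemma L2_diff:
  assumes "f \<in> L2 M" "g \<in> L2 M"
  shows "(\<lambda>x. f x - g x) \<in> L2 M"
  using L2_add[OF assms(1) L2_mult_left[OF assms(2), of "-1"]] by simp

lemma L2_linear_combination:
  fixes n :: nat
  assumes "\<And>k. k < n \<Longrightarrow> \<phi> k \<in> L2 M"
  shows "(\<lambda>x. \<Sum>k<n. c k * \<phi> k x) \<in> L2 M"
  using assms
proof (induction n)
  case 0
  show ?case by (simp add: L2_def)
next
  case (Suc n)
  then show ?case by (simp add: L2_add L2_mult_left)
qed

lemma L2_inner_commute: "L2_inner M f g = L2_inner M g f"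
  by (simp add: L2_inner_def mult.commute)

lemma L2_inner_diff_left:
  assumes "f \<in> L2 M" "g \<in> L2 M" "h \<in> L2 M"
  shows "L2_inner M (\<lambda>x. f x - g x) h = L2_inner M f h - L2_inner M g h"
  using assms by (simp add: L2_inner_def left_diff_distrib L2_integrable_mult)

lemma L2_inner_linear_combination_left:
  fixes n :: nat
  assumes "\<And>k. k < n \<Longrightarrow> \<phi> k \<in> L2 M" "h \<in> L2 M"
  shows "L2_inner M (\<lambda>x. \<Sum>k<n. c k * \<phi> k x) h = (\<Sum>k<n. c k * L2_inner M (\<phi> k) h)"
  using assms
  by (simp add: L2_inner_def sum_distrib_right mult.assoc L2_integrable_mult
      Bochner_Integration.integral_sum)

lemma L2_inner_linear_combination_right:
  fixes n :: nat
  assumes "\<And>k. k < n \<Longrightarrow> \<phi> k \<in> L2 M" "h \<in> L2 M"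
  shows "L2_inner M h (\<lambda>x. \<Sum>k<n. c k * \<phi> k x) = (\<Sum>k<n. c k * L2_inner M h (\<phi> k))"
  using L2_inner_linear_combination_left[OF assms] by (simp add: L2_inner_commute)

lemma L2_inner_self_nonneg: "0 \<le> L2_inner M f f"
  by (simp add: L2_inner_def)

lemma L2_norm_square: "(L2_norm M f)\<^sup>2 = L2_inner M f f"
  by (simp add: L2_norm_def L2_inner_self_nonneg)

lemma L2_inner_self_eq_0_imp_AE:
  assumes "f \<in> L2 M" "L2_inner M f f = 0"
  shows "AE x in M. f x = 0"
  using assms integral_nonneg_eq_0_iff_AE[OF L2_integrable_mult[OF assms(1,1)]]
  by (simp add: L2_inner_def)

text \<open>Meant for an estimator \<open>e\<close>, a target \<open>f\<close> and the projection
  \<open>g\<close> of \<open>f\<close>: since \<open>e - f = (e - g) - (f - g)\<close>, only the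
  cross term has to vanish. The part depending on \<open>e\<close> stays an inner product, ready for
  expansion in a basis.\<close>

lemma L2_norm_square_pythagoras:
  assumes "e \<in> L2 M" "f \<in> L2 M" "g \<in> L2 M"
    and "L2_inner M (\<lambda>x. f x - g x) (\<lambda>x. e x - g x) = 0"
  shows "(L2_norm M (\<lambda>x. e x - f x))\<^sup>2 =
    (L2_norm M (\<lambda>x. f x - g x))\<^sup>2 + L2_inner M (\<lambda>x. e x - g x) (\<lambda>x. e x - g x)"
proof -
  define a where "a = (\<lambda>x. e x - g x)"
  define b where "b = (\<lambda>x. f x - g x)"
  have a: "a \<in> L2 M" and b: "b \<in> L2 M"
    using assms L2_diff by (auto simp: a_def b_def)
  have ab: "L2_inner M a b = 0"
    using assms(4) by (simp add: a_def b_def L2_inner_commute)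
  have eq: "(\<lambda>x. e x - f x) = (\<lambda>x. a x - b x)"
    by (simp add: a_def b_def)
  have "L2_inner M (\<lambda>x. a x - b x) (\<lambda>x. a x - b x) = L2_inner M a a + L2_inner M b b"
    using ab L2_inner_diff_left[OF a b L2_diff[OF a b]] L2_inner_diff_left[OF a b a]
      L2_inner_diff_left[OF a b b]
      L2_inner_commute[of M a "\<lambda>x. a x - b x"] L2_inner_commute[of M b "\<lambda>x. a x - b x"]
      L2_inner_commute[of M a b]
    by linarith
  then show ?thesis
    unfolding L2_norm_square eq by (simp add: a_def b_def)
qed

section \<open>The Gram matrix and the dual basis\<close>

text \<open>A trivial kernel gives a nonzero determinant, hence a unit of the matrix ring, and for
  units \<open>mat_inverse\<close> does not return \<open>None\<close>. This gives
  \<open>the (mat_inverse A)\<close> its intended meaning.\<close>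

lemma mat_inverse_eq_Some:
  fixes A :: "real mat"
  assumes A: "A \<in> carrier_mat n n"
    and inj: "\<And>v. v \<in> carrier_vec n \<Longrightarrow> A *\<^sub>v v = 0\<^sub>v n \<Longrightarrow> v = 0\<^sub>v n"
  obtains B where "mat_inverse A = Some B" "A * B = 1\<^sub>m n" "B \<in> carrier_mat n n"
proof -
  have "det A \<noteq> 0"
    using inj det_0_iff_vec_prod_zero_field[OF A] by blast
  then have "A \<in> Units (ring_mat TYPE(real) n ())"
    by (rule det_non_zero_imp_unit[OF A])
  then have "mat_inverse A \<noteq> None"
    using mat_inverse(1)[OF A, of "()"] by blast
  then show thesis
    using mat_inverse(2)[OF A] that by blast
qed

locale independent_pmf_family =
  fixes \<nu> :: "'a measure" and \<pi> :: "'a \<Rightarrow> nat pmf"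
  assumes Pi1_L2: "\<And>k. Pi1 \<pi> k \<in> L2 \<nu>"
    and independent: "lin_indep_seq \<nu> (Pi1 \<pi>)"
begin

lemma V_L2: "g \<in> V \<pi> m \<Longrightarrow> g \<in> L2 \<nu>"
  by (auto simp: V_def intro!: L2_linear_combination Pi1_L2)

lemma V_diff:
  assumes "g \<in> V \<pi> m" "h \<in> V \<pi> m"
  shows "(\<lambda>\<theta>. g \<theta> - h \<theta>) \<in> V \<pi> m"
proof -
  obtain c d where "g = (\<lambda>\<theta>. \<Sum>k<m. c k * Pi1 \<pi> k \<theta>)" "h = (\<lambda>\<theta>. \<Sum>k<m. d k * Pi1 \<pi> k \<theta>)"
    using assms by (auto simp: V_def)
  then have "(\<lambda>\<theta>. g \<theta> - h \<theta>) = (\<lambda>\<theta>. \<Sum>k<m. (c k - d k) * Pi1 \<pi> k \<theta>)"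
    by (simp add: left_diff_distrib sum_subtractf)
  then show ?thesis
    unfolding V_def mem_Collect_eq by (rule exI[of _ "\<lambda>k. c k - d k"])
qed

lemma V_orthogonal:
  assumes "h \<in> V \<pi> m" "g \<in> L2 \<nu>" "\<And>k. k < m \<Longrightarrow> L2_inner \<nu> g (Pi1 \<pi> k) = 0"
  shows "L2_inner \<nu> g h = 0"
proof -
  obtain c where h: "h = (\<lambda>\<theta>. \<Sum>k<m. c k * Pi1 \<pi> k \<theta>)"
    using assms by (auto simp: V_def)
  show ?thesis
    unfolding h using assms by (simp add: L2_inner_linear_combination_right Pi1_L2)
qed

text \<open>A combination of norm zero vanishes almost everywhere, which is the form of vanishing
  that \<open>lin_indep_seq\<close> speaks of. A statement about null sets thus becomes one about
  coefficients.\<close>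

lemma linear_combination_eq_0:
  assumes "L2_inner \<nu> (\<lambda>\<theta>. \<Sum>k<m. c k * Pi1 \<pi> k \<theta>) (\<lambda>\<theta>. \<Sum>k<m. c k * Pi1 \<pi> k \<theta>) = 0" "k < m"
  shows "c k = 0"
  using L2_inner_self_eq_0_imp_AE[OF L2_linear_combination assms(1)] assms(2) independent Pi1_L2
  unfolding lin_indep_seq_def by blast

text \<open>The difference lies in the span and is orthogonal to every generator, hence to itself,
  so its coefficients are zero. Elements of the span are therefore equal at every point, not just
  almost everywhere; the description by \<open>THE\<close> in \<open>proj_estimator\<close> relies
  on this.\<close>

lemma V_eqI:
  assumes "g \<in> V \<pi> m" "h \<in> V \<pi> m"
    and "\<And>k. k < m \<Longrightarrow> L2_inner \<nu> g (Pi1 \<pi> k) = L2_inner \<nu> h (Pi1 \<pi> k)"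
  shows "g = h"
proof -
  define d where "d = (\<lambda>\<theta>. g \<theta> - h \<theta>)"
  have d: "d \<in> V \<pi> m"
    unfolding d_def using assms by (intro V_diff)
  obtain c where c: "d = (\<lambda>\<theta>. \<Sum>k<m. c k * Pi1 \<pi> k \<theta>)"
    using d by (auto simp: V_def)
  have zero: "L2_inner \<nu> d d = 0"
    using assms V_L2[OF assms(1)] V_L2[OF assms(2)] V_L2[OF d]
    by (intro V_orthogonal[OF d]) (auto simp: d_def L2_inner_diff_left Pi1_L2)
  have "c k = 0" if "k < m" for k
    by (rule linear_combination_eq_0[OF zero[unfolded c] that])
  then have "d \<theta> = 0" for \<theta>
    by (simp add: c)
  then show ?thesis
    by (auto simp: d_def fun_eq_iff)
qed

text \<open>A kernel vector of the Gram matrix is the coefficient vector of a combination orthogonal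
  to all generators of the span it lies in. Such a combination has norm zero, so independence makes
  the vector zero.\<close>

lemma
  shows gram_inverse_carrier: "the (mat_inverse (gram_matrix \<nu> \<pi> m)) \<in> carrier_mat m m"
    and gram_mult_inverse: "gram_matrix \<nu> \<pi> m * the (mat_inverse (gram_matrix \<nu> \<pi> m)) = 1\<^sub>m m"
proof -
  let ?R = "gram_matrix \<nu> \<pi> m"
  have R: "?R \<in> carrier_mat m m"
    by (simp add: gram_matrix_def)
  have "v = 0\<^sub>v m" if v: "v \<in> carrier_vec m" "?R *\<^sub>v v = 0\<^sub>v m" for v
  proof -
    define h where "h = (\<lambda>\<theta>. \<Sum>k<m. vec_index v k * Pi1 \<pi> k \<theta>)"
    have "h \<in> V \<pi> m"
      by (auto simp: V_def h_def)
    moreover have "L2_inner \<nu> h (Pi1 \<pi> k) = 0" if k: "k < m" for k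
    proof -
      have "L2_inner \<nu> h (Pi1 \<pi> k) = (\<Sum>l<m. vec_index v l * L2_inner \<nu> (Pi1 \<pi> l) (Pi1 \<pi> k))"
        unfolding h_def by (rule L2_inner_linear_combination_left) (auto simp: Pi1_L2)
      also have "\<dots> = vec_index (?R *\<^sub>v v) k"
        using k v(1) by (simp add: gram_matrix_def scalar_prod_def mult.commute lessThan_atLeast0
            L2_inner_commute[of \<nu> "Pi1 \<pi> k"])
      finally show ?thesis
        using v(2) k by simp
    qed
    ultimately have zero: "L2_inner \<nu> h h = 0"
      using V_L2 V_orthogonal by blast
    have "vec_index v k = 0" if "k < m" for k
      by (rule linear_combination_eq_0[OF zero[unfolded h_def] that])
    then show ?thesis
      using v by auto
  qed
  with R obtain B where "mat_inverse ?R = Some B" "?R * B = 1\<^sub>m m" "B \<in> carrier_mat m m"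
    by (rule mat_inverse_eq_Some)
  then show "the (mat_inverse ?R) \<in> carrier_mat m m" "?R * the (mat_inverse ?R) = 1\<^sub>m m"
    by simp_all
qed

text \<open>The basis of the span biorthogonal to the functions \<open>Pi1 \<pi> k\<close>. It
  depends on \<open>m\<close> as well as on \<open>j\<close>, since the whole inverse changes with
  the size of the Gram matrix.\<close>

definition dual :: "nat \<Rightarrow> nat \<Rightarrow> 'a \<Rightarrow> real" where
  "dual m j = (\<lambda>\<theta>. \<Sum>l<m. the (mat_inverse (gram_matrix \<nu> \<pi> m)) $$ (l, j) * Pi1 \<pi> l \<theta>)"

lemma dual_V: "dual m j \<in> V \<pi> m"
  unfolding V_def dual_def mem_Collect_eq by (rule exI) (rule refl)

lemmas dual_L2 = V_L2[OF dual_V]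

text \<open>By symmetry of the Gram matrix the inner product is the entry \<open>(k, j)\<close> of
  that matrix times its inverse.\<close>

lemma dual_inner_Pi1:
  assumes "j < m" "k < m"
  shows "L2_inner \<nu> (dual m j) (Pi1 \<pi> k) = (if j = k then 1 else 0)"
proof -
  let ?R = "gram_matrix \<nu> \<pi> m" and ?S = "the (mat_inverse (gram_matrix \<nu> \<pi> m))"
  note S = gram_inverse_carrier[of m] gram_mult_inverse[of m]
  have "L2_inner \<nu> (dual m j) (Pi1 \<pi> k) = (\<Sum>l<m. ?S $$ (l, j) * L2_inner \<nu> (Pi1 \<pi> l) (Pi1 \<pi> k))"
    unfolding dual_def by (rule L2_inner_linear_combination_left) (auto simp: Pi1_L2)
  also have "\<dots> = (?R * ?S) $$ (k, j)"
    using assms S(1) by (simp add: gram_matrix_def scalar_prod_def mult.commute lessThan_atLeast0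
        L2_inner_commute[of \<nu> "Pi1 \<pi> k"])
  also have "\<dots> = (if j = k then 1 else 0)"
    using S assms by auto
  finally show ?thesis .
qed

text \<open>Only the second factor is expanded; biorthogonality then selects the coefficient of
  \<open>Pi1 \<pi> j\<close>.\<close>

lemma dual_inner_dual:
  assumes "j < m" "k < m"
  shows "L2_inner \<nu> (dual m j) (dual m k) = the (mat_inverse (gram_matrix \<nu> \<pi> m)) $$ (j, k)"
proof -
  have "L2_inner \<nu> (dual m j) (dual m k) =
      (\<Sum>l<m. the (mat_inverse (gram_matrix \<nu> \<pi> m)) $$ (l, k) * L2_inner \<nu> (dual m j) (Pi1 \<pi> l))"
    unfolding dual_def[of m k]
    by (rule L2_inner_linear_combination_right) (auto simp: Pi1_L2 dual_L2)
  also have "\<dots> = (\<Sum>l<m. if l = j then the (mat_inverse (gram_matrix \<nu> \<pi> m)) $$ (l, k) else 0)"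
    using assms by (intro sum.cong) (auto simp: dual_inner_Pi1)
  finally show ?thesis
    using assms by simp
qed

lemma dual_combination_V: "(\<lambda>\<theta>. \<Sum>j<m. a j * dual m j \<theta>) \<in> V \<pi> m"
proof -
  let ?S = "the (mat_inverse (gram_matrix \<nu> \<pi> m))"
  have "(\<lambda>\<theta>. \<Sum>j<m. a j * dual m j \<theta>) = (\<lambda>\<theta>. \<Sum>l<m. (\<Sum>j<m. a j * ?S $$ (l, j)) * Pi1 \<pi> l \<theta>)"
    unfolding dual_def sum_distrib_left sum_distrib_right
    by (subst sum.swap) (simp add: mult.assoc)
  then show ?thesis
    unfolding V_def mem_Collect_eq by (rule exI[of _ "\<lambda>l. \<Sum>j<m. a j * ?S $$ (l, j)"])
qed

lemma dual_combination_inner_Pi1: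
  assumes "k < m"
  shows "L2_inner \<nu> (\<lambda>\<theta>. \<Sum>j<m. a j * dual m j \<theta>) (Pi1 \<pi> k) = a k"
proof -
  have "L2_inner \<nu> (\<lambda>\<theta>. \<Sum>j<m. a j * dual m j \<theta>) (Pi1 \<pi> k) =
      (\<Sum>j<m. a j * L2_inner \<nu> (dual m j) (Pi1 \<pi> k))"
    by (rule L2_inner_linear_combination_left) (auto simp: Pi1_L2 dual_L2)
  also have "\<dots> = (\<Sum>j<m. if j = k then a j else 0)"
    using assms by (intro sum.cong) (auto simp: dual_inner_Pi1)
  finally show ?thesis
    using assms by simp
qed

text \<open>The products \<open>a j * a k\<close> are kept together because for random coefficients
  they are the only random part, so expectations can be taken entry by entry.\<close>

lemma dual_combination_inner_self:
  "L2_inner \<nu> (\<lambda>\<theta>. \<Sum>j<m. a j * dual m j \<theta>) (\<lambda>\<theta>. \<Sum>j<m. a j * dual m j \<theta>) =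
    (\<Sum>j<m. \<Sum>k<m. L2_inner \<nu> (dual m j) (dual m k) * (a j * a k))"
proof -
  let ?h = "\<lambda>\<theta>. \<Sum>j<m. a j * dual m j \<theta>"
  have "L2_inner \<nu> ?h ?h = (\<Sum>j<m. a j * L2_inner \<nu> (dual m j) ?h)"
    by (rule L2_inner_linear_combination_left) (auto simp: dual_L2 intro!: L2_linear_combination)
  also have "\<dots> = (\<Sum>j<m. a j * (\<Sum>k<m. a k * L2_inner \<nu> (dual m j) (dual m k)))"
    by (simp add: L2_inner_linear_combination_right dual_L2)
  finally show ?thesis
    by (simp add: sum_distrib_left ac_simps)
qed

section \<open>Explicit form of the estimator and of the projection\<close>

text \<open>Biorthogonality makes the combination satisfy the defining equations, and
  \<open>V_eqI\<close> makes it the only element of the span that does.\<close>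

lemma proj_estimator_eq:
  "proj_estimator \<nu> \<pi> m n X = (\<lambda>\<theta>. \<Sum>j<m. empirical n X j * dual m j \<theta>)"
  unfolding proj_estimator_def
  by (rule the_equality) (auto simp: dual_combination_V dual_combination_inner_Pi1 intro!: V_eqI)

text \<open>The combination on the right has the same inner products with the generators as
  \<open>f\<close>, so it is a possible choice for \<open>SOME\<close>. Every choice has these inner
  products, so \<open>V_eqI\<close> identifies it with this one.\<close>

lemma Proj_eq:
  assumes "f \<in> L2 \<nu>"
  shows "Proj \<nu> (V \<pi> m) f = (\<lambda>\<theta>. \<Sum>j<m. mixture \<nu> \<pi> f j * dual m j \<theta>)"
    (is "?P = ?g")
proof -
  have mix: "L2_inner \<nu> f (Pi1 \<pi> k) = mixture \<nu> \<pi> f k" for k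
    by (simp add: L2_inner_def mixture_def Pi1_def mult.commute)
  have g: "?g \<in> V \<pi> m"
    by (rule dual_combination_V)
  have "L2_inner \<nu> (\<lambda>\<theta>. f \<theta> - ?g \<theta>) h = 0" if "h \<in> V \<pi> m" for h
    by (rule V_orthogonal[OF that])
      (auto simp: L2_inner_diff_left L2_diff V_L2[OF g] Pi1_L2 assms mix dual_combination_inner_Pi1)
  with g have "?P \<in> V \<pi> m \<and> (\<forall>h\<in>V \<pi> m. L2_inner \<nu> (\<lambda>\<theta>. f \<theta> - ?P \<theta>) h = 0)"
    unfolding Proj_def
    by (intro someI[where P = "\<lambda>g. g \<in> V \<pi> m \<and> (\<forall>h\<in>V \<pi> m. L2_inner \<nu> (\<lambda>\<theta>. f \<theta> - g \<theta>) h = 0)"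
          and x = ?g]) blast
  then have P: "?P \<in> V \<pi> m" and orth: "\<And>h. h \<in> V \<pi> m \<Longrightarrow> L2_inner \<nu> (\<lambda>\<theta>. f \<theta> - ?P \<theta>) h = 0"
    by auto
  \<comment> \<open>The generators are themselves admissible test functions for the orthogonality
    \<open>orth\<close>.\<close>
  have "Pi1 \<pi> k \<in> V \<pi> m" if "k < m" for k
  proof -
    have "(\<Sum>l<m. (if l = k then 1 else 0) * Pi1 \<pi> l \<theta>) = (\<Sum>l<m. if l = k then Pi1 \<pi> l \<theta> else 0)" for \<theta>
      by (intro sum.cong) auto
    then show ?thesis
      unfolding V_def mem_Collect_eq
      using that by (intro exI[of _ "\<lambda>l. if l = k then 1 else 0"]) simp
  qed
  then have "L2_inner \<nu> ?P (Pi1 \<pi> k) = mixture \<nu> \<pi> f k" if "k < m" for k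
    using orth[of "Pi1 \<pi> k"] that V_L2[OF P] by (simp add: L2_inner_diff_left assms Pi1_L2 mix)
  then show ?thesis
    using P g by (intro V_eqI) (auto simp: dual_combination_inner_Pi1)
qed

text \<open>The estimator minus the projection lies in the span, to which \<open>f\<close> minus its
  projection is orthogonal. The sample \<open>X\<close> enters only the quadratic form, through
  products of centered frequencies.\<close>

lemma squared_error_decomposition:
  assumes f: "f \<in> L2 \<nu>"
  shows "(L2_norm \<nu> (\<lambda>\<theta>. proj_estimator \<nu> \<pi> m n X \<theta> - f \<theta>))\<^sup>2 =
    (L2_norm \<nu> (\<lambda>\<theta>. f \<theta> - Proj \<nu> (V \<pi> m) f \<theta>))\<^sup>2 +
    (\<Sum>j<m. \<Sum>k<m. L2_inner \<nu> (dual m j) (dual m k) *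
      ((empirical n X j - mixture \<nu> \<pi> f j) * (empirical n X k - mixture \<nu> \<pi> f k)))"
proof -
  let ?P = "Proj \<nu> (V \<pi> m) f" and ?E = "proj_estimator \<nu> \<pi> m n X"
  have P: "?P \<in> V \<pi> m" and E: "?E \<in> V \<pi> m"
    by (simp_all add: Proj_eq[OF f] proj_estimator_eq dual_combination_V)
  have mix: "L2_inner \<nu> f (Pi1 \<pi> k) = mixture \<nu> \<pi> f k" for k
    by (simp add: L2_inner_def mixture_def Pi1_def mult.commute)
  have "L2_inner \<nu> (\<lambda>\<theta>. f \<theta> - ?P \<theta>) (\<lambda>\<theta>. ?E \<theta> - ?P \<theta>) = 0"
    by (rule V_orthogonal[OF V_diff[OF E P] L2_diff[OF f V_L2[OF P]]])
      (simp add: L2_inner_diff_left[OF f V_L2[OF P]] Pi1_L2 mix,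
        simp add: Proj_eq[OF f] dual_combination_inner_Pi1)
  then have "(L2_norm \<nu> (\<lambda>\<theta>. ?E \<theta> - f \<theta>))\<^sup>2 = (L2_norm \<nu> (\<lambda>\<theta>. f \<theta> - ?P \<theta>))\<^sup>2
      + L2_inner \<nu> (\<lambda>\<theta>. ?E \<theta> - ?P \<theta>) (\<lambda>\<theta>. ?E \<theta> - ?P \<theta>)"
    by (rule L2_norm_square_pythagoras[OF V_L2[OF E] f V_L2[OF P]])
  moreover have "(\<lambda>\<theta>. ?E \<theta> - ?P \<theta>) =
      (\<lambda>\<theta>. \<Sum>j<m. (empirical n X j - mixture \<nu> \<pi> f j) * dual m j \<theta>)"
    by (simp add: Proj_eq[OF f] proj_estimator_eq left_diff_distrib sum_subtractf)
  ultimately show ?thesis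
    by (simp add: dual_combination_inner_self)
qed

text \<open>The second factor is diagonal, so the trace involves only the diagonal of the inverse,
  whose entries are the squared norms of the dual functions.\<close>

lemma trace_gram_inverse_Delta:
  "mat_trace (the (mat_inverse (gram_matrix \<nu> \<pi> m)) * Delta_matrix \<nu> \<pi> w m) =
    (\<Sum>k<m. L2_inner \<nu> (dual m k) (dual m k) * L2_inner \<nu> w (Pi1 \<pi> k))"
proof -
  let ?S = "the (mat_inverse (gram_matrix \<nu> \<pi> m))"
  note S = gram_inverse_carrier[of m]
  have "mat_trace (?S * Delta_matrix \<nu> \<pi> w m) =
      (\<Sum>k<m. ?S $$ (k, k) * L2_inner \<nu> w (Pi1 \<pi> k))"
    using S unfolding mat_trace_def Delta_matrix_def mat_diag_mult_right[OF S] diag_mat_def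
    by (simp add: sum_list_distinct_conv_sum_set lessThan_atLeast0)
  then show ?thesis
    by (simp add: dual_inner_dual)
qed

end

section \<open>Covariance of the empirical frequencies\<close>

text \<open>Centered frequencies are averages of centered indicators. In the product of two
  averages, terms from distinct observations have mean zero by independence, and the
  \<open>n\<close> remaining terms, divided by the square of \<open>n\<close>, leave the factor
  \<open>1 / n\<close>. Since \<open>sets N = UNIV\<close>, every real function on the sample space
  of one observation is measurable.\<close>

lemma empirical_covariance:
  fixes N :: "nat measure"
  assumes N: "prob_space N" and sets_N: "sets N = UNIV" and n: "1 \<le> n"
  shows "has_bochner_integral (PiM {1..n} (\<lambda>_. N))
    (\<lambda>X. (empirical n X k - measure N {k}) * (empirical n X l - measure N {l}))
    (((if k = l then measure N {k} else 0) - measure N {k} * measure N {l}) / real n)"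
proof -
  let ?P = "PiM {1..n} (\<lambda>_. N)"
  interpret N: prob_space N by (rule N)
  interpret P: prob_space ?P
    by (rule prob_space_PiM) (rule N)
  interpret product_sigma_finite "\<lambda>_::nat. N"
    by unfold_locales
  have space_N: "space N = UNIV"
    using sets_N sets.top[of N] sets.sets_into_space[of UNIV N] by auto
  have meas [measurable]: "g \<in> borel_measurable N" for g :: "nat \<Rightarrow> real"
    by (rule measurableI) (auto simp: sets_N)
  define p where "p k = measure N {k}" for k
  define Z where "Z k x = indicator {k} x - p k" for k x
  have p01: "0 \<le> p k" "p k \<le> 1" for k
    by (auto simp: p_def)
  have Z_bound: "\<bar>Z k x\<bar> \<le> 1" for k x
    using p01[of k] by (auto simp: Z_def indicator_def)
  have Z_int: "integrable N (Z k)" for k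
    using Z_bound by (intro N.integrable_const_bound[where B = 1]) auto
  have Z_mean: "(LINT x|N. Z k x) = 0" for k
  proof -
    have "integrable N (indicator {k} :: nat \<Rightarrow> real)"
      by (intro integrable_real_indicator) (auto simp: sets_N N.emeasure_finite less_top[symmetric])
    then show ?thesis
      unfolding Z_def p_def by (simp add: space_N N.prob_space[unfolded space_N])
  qed
  have Z_cov: "(LINT x|N. Z k x * Z l x) = (if k = l then p k else 0) - p k * p l"
  proof -
    have ind: "integrable N (indicator {k} :: nat \<Rightarrow> real)" for k
      by (intro integrable_real_indicator) (auto simp: sets_N N.emeasure_finite less_top[symmetric])
    have "(LINT x|N. Z k x * Z l x) =
        (LINT x|N. (if k = l then indicator {k} x else 0) - p l * indicator {k} x - p k * indicator {l} x + p k * p l)"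
      by (intro Bochner_Integration.integral_cong) (auto simp: Z_def indicator_def algebra_simps)
    also have "\<dots> = (if k = l then p k else 0) - p l * p k - p k * p l + p k * p l"
      using ind by (simp add: space_N N.prob_space[unfolded space_N] p_def)
    finally show ?thesis by simp
  qed
  \<comment> \<open>Each coordinate has law \<open>N\<close>; this settles the terms with
    \<open>i = j\<close>.\<close>
  have comp: "(LINT X|?P. g (X i)) = (LINT x|N. g x)" if "i \<in> {1..n}" for g :: "nat \<Rightarrow> real" and i
  proof -
    have "(LINT x|N. g x) = (LINT x|distr ?P N (\<lambda>X. X i). g x)"
      using distr_PiM_component[of "{1..n}" "\<lambda>_. N" i] that N by simp
    also have "\<dots> = (LINT X|?P. g (X i))"
      using that by (intro integral_distr) (auto intro: measurable_component_singleton)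
    finally show ?thesis by simp
  qed
  have prod_int: "integrable ?P (\<lambda>X. Z k (X i) * Z l (X j))" if "i \<in> {1..n}" "j \<in> {1..n}" for i j
  proof (rule P.integrable_const_bound[where B = 1])
    show "AE X in ?P. norm (Z k (X i) * Z l (X j)) \<le> 1"
      using Z_bound by (simp add: abs_mult mult_le_one)
    show "(\<lambda>X. Z k (X i) * Z l (X j)) \<in> borel_measurable ?P"
      using that by measurable
  qed
  have prod_mean: "(LINT X|?P. Z k (X i) * Z l (X j)) =
      (if i = j then (if k = l then p k else 0) - p k * p l else 0)"
    if ij: "i \<in> {1..n}" "j \<in> {1..n}" for i j
  proof (cases "i = j")
    case True
    then show ?thesis
      using comp[OF ij(1), of "\<lambda>x. Z k x * Z l x"] Z_cov by simp
  next
    case False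
    \<comment> \<open>Padding with the constant 1 turns a product of two coordinates into one over
      all coordinates, so that the integral factorizes; the factor at \<open>i\<close> is then the
      mean of \<open>Z k\<close>, which is zero.\<close>
    define g where "g h = (if h = i then Z k else if h = j then Z l else (\<lambda>_. 1))" for h
    have "(LINT X|?P. Z k (X i) * Z l (X j)) = (LINT X|?P. (\<Prod>h\<in>{1..n}. g h (X h)))"
    proof (rule Bochner_Integration.integral_cong)
      fix X
      have "(\<Prod>h\<in>{1..n}. g h (X h)) = (\<Prod>h\<in>{i, j}. g h (X h))"
        using ij by (intro prod.mono_neutral_right) (auto simp: g_def)
      then show "Z k (X i) * Z l (X j) = (\<Prod>h\<in>{1..n}. g h (X h))"
        using False by (simp add: g_def)
    qed simp
    also have "\<dots> = (\<Prod>h\<in>{1..n}. LINT x|N. g h x)"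
      by (rule product_integral_prod) (auto simp: g_def Z_int)
    also have "\<dots> = 0"
      using ij(1) by (intro prod_zero) (auto simp: g_def Z_mean)
    finally show ?thesis
      using False by simp
  qed
  have center: "empirical n X k - p k = (\<Sum>i=1..n. Z k (X i)) / real n" for X k
  proof -
    have "(\<Sum>i=1..n. indicator {k} (X i)) = (\<Sum>i=1..n. if X i = k then 1 else (0::real))"
      by (intro sum.cong) auto
    also have "\<dots> = real (card {i \<in> {1..n}. X i = k})"
      by (subst sum.inter_filter[symmetric]) auto
    finally have "(\<Sum>i=1..n. indicator {k} (X i)) = real (card {i \<in> {1..n}. X i = k})" .
    then show ?thesis
      using n by (simp add: empirical_def Z_def sum_subtractf field_simps)
  qed
  have "has_bochner_integral ?P
      (\<lambda>X. (\<Sum>i=1..n. \<Sum>j=1..n. Z k (X i) * Z l (X j)) / (real n * real n))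
      ((\<Sum>i=1..n. \<Sum>j=1..n. if i = j then (if k = l then p k else 0) - p k * p l else 0)
        / (real n * real n))"
    using n prod_int prod_mean
    by (intro has_bochner_integral_divide has_bochner_integral_sum)
      (auto simp: has_bochner_integral_iff)
  moreover have "(\<Sum>i=1..n. \<Sum>j=1..n. if i = j then (if k = l then p k else 0) - p k * p l else 0)
        / (real n * real n) = ((if k = l then p k else 0) - p k * p l) / real n"
    using n by simp
  ultimately show ?thesis
    unfolding p_def[symmetric] center times_divide_times_eq sum_product by (simp only:)
qed

section \<open>The risk and its bound\<close>

context independent_pmf_family
begin

lemma mixture_nonneg:
  assumes "f \<in> L2_nonneg \<nu>"
  shows "0 \<le> mixture \<nu> \<pi> f k"
  unfolding mixture_def using assms
  by (intro integral_nonneg_AE) (auto simp: L2_nonneg_def)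

text \<open>Summation over \<open>k\<close> is exchanged with integration by monotone convergence,
  which is why the mixture is first rewritten as an integral of extended nonnegative functions. The
  masses of \<open>\<pi> \<theta>\<close> add up to 1, and so the total is the integral of
  \<open>f\<close>.\<close>

lemma mixture_prob_space:
  assumes f: "f \<in> L2_densities \<nu>"
  shows "prob_space (point_measure UNIV (\<lambda>k. ennreal (mixture \<nu> \<pi> f k)))"
proof
  have L2: "f \<in> L2 \<nu>" and nonneg: "AE \<theta> in \<nu>. 0 \<le> f \<theta>"
    and int: "integrable \<nu> f" "(LINT \<theta>|\<nu>. f \<theta>) = 1"
    using f by (auto simp: L2_densities_def L2_nonneg_def)
  have [measurable]: "f \<in> borel_measurable \<nu>" "\<And>k. (\<lambda>\<theta>. pmf (\<pi> \<theta>) k) \<in> borel_measurable \<nu>"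
    using L2 Pi1_L2 by (auto simp: L2_def Pi1_def[abs_def])
  have mix: "ennreal (mixture \<nu> \<pi> f k) = (\<integral>\<^sup>+\<theta>. ennreal (pmf (\<pi> \<theta>) k) * ennreal (f \<theta>) \<partial>\<nu>)" for k
  proof -
    have "integrable \<nu> (\<lambda>\<theta>. pmf (\<pi> \<theta>) k * f \<theta>)"
      using L2_integrable_mult[OF Pi1_L2 L2, of k] by (simp add: Pi1_def)
    then have "ennreal (mixture \<nu> \<pi> f k) = (\<integral>\<^sup>+\<theta>. ennreal (pmf (\<pi> \<theta>) k * f \<theta>) \<partial>\<nu>)"
      unfolding mixture_def using nonneg by (intro nn_integral_eq_integral[symmetric]) auto
    also have "\<dots> = (\<integral>\<^sup>+\<theta>. ennreal (pmf (\<pi> \<theta>) k) * ennreal (f \<theta>) \<partial>\<nu>)"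
      by (simp add: ennreal_mult')
    finally show ?thesis .
  qed
  have "(\<Sum>k. ennreal (mixture \<nu> \<pi> f k)) =
      (\<integral>\<^sup>+\<theta>. (\<Sum>k. ennreal (pmf (\<pi> \<theta>) k) * ennreal (f \<theta>)) \<partial>\<nu>)"
    unfolding mix by (rule nn_integral_suminf[symmetric]) simp
  also have "\<dots> = (\<integral>\<^sup>+\<theta>. ennreal (f \<theta>) \<partial>\<nu>)"
    by (simp add: nn_integral_pmf_eq_1 flip: nn_integral_count_space_nat)
  also have "\<dots> = 1"
    using nonneg int by (simp add: nn_integral_eq_integral)
  finally have "(\<integral>\<^sup>+k. ennreal (mixture \<nu> \<pi> f k) \<partial>count_space UNIV) = 1"
    by (simp add: nn_integral_count_space_nat)
  then show "emeasure (point_measure UNIV (\<lambda>k. ennreal (mixture \<nu> \<pi> f k)))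
      (space (point_measure UNIV (\<lambda>k. ennreal (mixture \<nu> \<pi> f k)))) = 1"
    by (simp add: point_measure_def emeasure_density space_point_measure)
qed

text \<open>Integrating the error decomposition replaces the products of centered frequencies by
  their covariances; the squared bias is constant under a probability measure. The value is exact,
  and no bound on \<open>f\<close> enters.\<close>

lemma risk_eq:
  assumes f: "f \<in> L2_densities \<nu>" and n: "1 \<le> n"
  shows "risk \<nu> \<pi> m n f = ennreal ((L2_norm \<nu> (\<lambda>\<theta>. f \<theta> - Proj \<nu> (V \<pi> m) f \<theta>))\<^sup>2 +
    ((\<Sum>k<m. L2_inner \<nu> (dual m k) (dual m k) * mixture \<nu> \<pi> f k)
      - (L2_norm \<nu> (Proj \<nu> (V \<pi> m) f))\<^sup>2) / real n)"
proof -
  let ?N = "point_measure UNIV (\<lambda>k. ennreal (mixture \<nu> \<pi> f k))"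
  let ?P = "sample_measure \<nu> \<pi> f n"
  let ?p = "mixture \<nu> \<pi> f" and ?S = "\<lambda>j k. L2_inner \<nu> (dual m j) (dual m k)"
  let ?b = "(L2_norm \<nu> (\<lambda>\<theta>. f \<theta> - Proj \<nu> (V \<pi> m) f \<theta>))\<^sup>2"
  have L2: "f \<in> L2 \<nu>" and nonneg: "f \<in> L2_nonneg \<nu>"
    using f by (auto simp: L2_densities_def L2_nonneg_def)
  interpret N: prob_space ?N
    by (rule mixture_prob_space[OF f])
  interpret P: prob_space ?P
    unfolding sample_measure_def by (rule prob_space_PiM) (rule N.prob_space_axioms)
  have p: "measure ?N {k} = ?p k" for k
    using mixture_nonneg[OF nonneg] by (simp add: measure_def emeasure_point_measure_finite2)
  have cov: "has_bochner_integral ?P (\<lambda>X. (empirical n X j - ?p j) * (empirical n X k - ?p k))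
      (((if j = k then ?p j else 0) - ?p j * ?p k) / real n)" for j k
    using empirical_covariance[OF N.prob_space_axioms _ n, of j k]
    unfolding p sample_measure_def by (simp add: sets_point_measure)
  have "has_bochner_integral ?P
      (\<lambda>X. ?b + (\<Sum>j<m. \<Sum>k<m. ?S j k * ((empirical n X j - ?p j) * (empirical n X k - ?p k))))
      (?b + (\<Sum>j<m. \<Sum>k<m. ?S j k * (((if j = k then ?p j else 0) - ?p j * ?p k) / real n)))"
    using cov by (intro has_bochner_integral_add has_bochner_integral_sum has_bochner_integral_mult_right)
      (auto simp: has_bochner_integral_iff P.prob_space)
  then have "has_bochner_integral ?P (\<lambda>X. (L2_norm \<nu> (\<lambda>\<theta>. proj_estimator \<nu> \<pi> m n X \<theta> - f \<theta>))\<^sup>2)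
      (?b + (\<Sum>j<m. \<Sum>k<m. ?S j k * (((if j = k then ?p j else 0) - ?p j * ?p k) / real n)))"
    by (simp only: squared_error_decomposition[OF L2])
  then have "risk \<nu> \<pi> m n f =
      ennreal (?b + (\<Sum>j<m. \<Sum>k<m. ?S j k * (((if j = k then ?p j else 0) - ?p j * ?p k) / real n)))"
    unfolding risk_def by (simp add: has_bochner_integral_iff nn_integral_eq_integral)
  \<comment> \<open>The covariance splits into a diagonal part, which leaves a single sum, and a
    rank-one part, which is the quadratic form of the projection of \<open>f\<close>.\<close>
  also have "(\<Sum>j<m. \<Sum>k<m. ?S j k * (((if j = k then ?p j else 0) - ?p j * ?p k) / real n)) =
      ((\<Sum>j<m. \<Sum>k<m. if j = k then ?S j k * ?p j else 0) - (\<Sum>j<m. \<Sum>k<m. ?S j k * (?p j * ?p k))) / real n"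
    unfolding sum_subtractf[symmetric] sum_divide_distrib
    by (intro sum.cong) (auto simp: algebra_simps)
  also have "(\<Sum>j<m. \<Sum>k<m. ?S j k * (?p j * ?p k)) = (L2_norm \<nu> (Proj \<nu> (V \<pi> m) f))\<^sup>2"
    by (simp add: L2_norm_square Proj_eq[OF L2] dual_combination_inner_self)
  finally show ?thesis
    by simp
qed

text \<open>The weighted bound amounts to \<open>f \<theta> \<le> K * w \<theta>\<close> almost
  everywhere, which is then integrated against the nonnegative function
  \<open>Pi1 \<pi> k\<close>.\<close>

lemma mixture_le:
  assumes f: "f \<in> L2_nonneg \<nu>" and w: "w \<in> L2_nonneg \<nu>" and "0 < K"
    and sup: "weighted_sup_norm \<nu> w f \<le> ennreal K"
  shows "mixture \<nu> \<pi> f k \<le> K * L2_inner \<nu> w (Pi1 \<pi> k)"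
proof -
  \<comment> \<open>Where the weight \<open>b\<close> vanishes, the quotient is infinite unless
    \<open>a = 0\<close>, so the finite bound \<open>K\<close> forces \<open>a = 0\<close>.\<close>
  have le: "a \<le> K * b" if "0 \<le> a" "0 \<le> b" "ennreal \<bar>a\<bar> / ennreal b \<le> ennreal K" for a b
  proof (cases "b = 0")
    case True
    then have "a = 0"
      using that by (cases "a = 0") (auto simp: ennreal_divide_zero top_unique)
    then show ?thesis using True by simp
  next
    case False
    then have "ennreal (a / b) \<le> ennreal K"
      using that by (simp add: divide_ennreal)
    then show ?thesis
      using that False \<open>0 < K\<close> by (simp add: field_simps)
  qed
  have "AE \<theta> in \<nu>. ennreal \<bar>f \<theta>\<bar> / ennreal (w \<theta>) \<le> ennreal K"
    using esssup_AE[of "\<lambda>\<theta>. ennreal \<bar>f \<theta>\<bar> / ennreal (w \<theta>)" \<nu>] sup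
    unfolding weighted_sup_norm_def by (auto elim!: eventually_mono)
  moreover have "AE \<theta> in \<nu>. 0 \<le> f \<theta>" "AE \<theta> in \<nu>. 0 \<le> w \<theta>"
    using f w by (auto simp: L2_nonneg_def)
  ultimately have "AE \<theta> in \<nu>. Pi1 \<pi> k \<theta> * f \<theta> \<le> K * (w \<theta> * Pi1 \<pi> k \<theta>)"
  proof eventually_elim
    case (elim \<theta>)
    then have "Pi1 \<pi> k \<theta> * f \<theta> \<le> Pi1 \<pi> k \<theta> * (K * w \<theta>)"
      by (intro mult_left_mono le) (auto simp: Pi1_def)
    then show ?case by (simp add: ac_simps)
  qed
  then have "(LINT \<theta>|\<nu>. Pi1 \<pi> k \<theta> * f \<theta>) \<le> (LINT \<theta>|\<nu>. K * (w \<theta> * Pi1 \<pi> k \<theta>))"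
    using f w Pi1_L2 by (intro integral_mono_AE integrable_mult_right L2_integrable_mult)
      (auto simp: L2_nonneg_def)
  then show ?thesis
    by (simp add: mixture_def L2_inner_def Pi1_def)
qed

text \<open>The weights in the variance term are squared norms and hence nonnegative, so
  \<open>mixture_le\<close> may be applied to each summand; the resulting sum is \<open>K\<close>
  times the trace. The bias is bounded by membership in the approximation class at index
  \<open>m\<close>.\<close>

lemma risk_le:
  assumes f: "f \<in> L2_densities \<nu>" "f \<in> bounded_approx_class \<nu> \<pi> w K u C r"
    and w: "w \<in> L2_nonneg \<nu>" and K: "0 < K" and n: "1 \<le> n" and m: "r \<le> m"
  shows "risk \<nu> \<pi> m n f \<le> ennreal ((C * u m)\<^sup>2 + K / real n *
    mat_trace (the (mat_inverse (gram_matrix \<nu> \<pi> m)) * Delta_matrix \<nu> \<pi> w m))"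
proof -
  have bias: "L2_norm \<nu> (\<lambda>\<theta>. f \<theta> - Proj \<nu> (V \<pi> m) f \<theta>) \<le> C * u m"
    and sup: "weighted_sup_norm \<nu> w f \<le> ennreal K"
    using f m by (auto simp: bounded_approx_class_def approx_class_def)
  have nonneg: "f \<in> L2_nonneg \<nu>"
    using f by (simp add: L2_densities_def)
  have "(\<Sum>k<m. L2_inner \<nu> (dual m k) (dual m k) * mixture \<nu> \<pi> f k) \<le>
      (\<Sum>k<m. L2_inner \<nu> (dual m k) (dual m k) * (K * L2_inner \<nu> w (Pi1 \<pi> k)))"
    by (intro sum_mono mult_left_mono mixture_le nonneg w K sup L2_inner_self_nonneg)
  also have "\<dots> = K * mat_trace (the (mat_inverse (gram_matrix \<nu> \<pi> m)) * Delta_matrix \<nu> \<pi> w m)"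
    by (simp add: trace_gram_inverse_Delta sum_distrib_left ac_simps)
  finally have "(\<Sum>k<m. L2_inner \<nu> (dual m k) (dual m k) * mixture \<nu> \<pi> f k)
      - (L2_norm \<nu> (Proj \<nu> (V \<pi> m) f))\<^sup>2
      \<le> K * mat_trace (the (mat_inverse (gram_matrix \<nu> \<pi> m)) * Delta_matrix \<nu> \<pi> w m)"
    \<comment> \<open>The squared norm of the projection enters with a minus sign and is
      discarded.\<close>
    using zero_le_power2[of "L2_norm \<nu> (Proj \<nu> (V \<pi> m) f)"] by linarith
  from divide_right_mono[OF this, of "real n"] show ?thesis
    unfolding risk_eq[OF f(1) n]
    by (intro ennreal_leI add_mono power_mono bias) (auto simp: L2_norm_def L2_inner_self_nonneg)
qed

end

theorem theorem2:
  fixes \<Theta> :: "(real ^ 'd) set"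
    and \<nu> :: "(real ^ 'd) measure"
    and \<pi> :: "real ^ 'd \<Rightarrow> nat pmf"
    and f_inf :: "real ^ 'd \<Rightarrow> real"
    and u :: "nat \<Rightarrow> real"
    and K C :: real
    and r n m :: nat
  assumes "\<Theta> \<in> sets borel"
    and "radon_measure_on \<Theta> \<nu>"
    and "\<And>k. (\<lambda>\<theta>. pmf (\<pi> \<theta>) k) \<in> borel_measurable (restrict_space borel \<Theta>)"
    and "f_inf \<in> L2_nonneg \<nu>"
    and "\<And>k. 0 < u k"
    and "decseq u"
    and "0 < K"
    and "0 < C"
    and "\<And>k. Pi1 \<pi> k \<in> L2 \<nu>"
    and "\<And>k. integrable \<nu> (Pi1 \<pi> k)"
    and "lin_indep_seq \<nu> (Pi1 \<pi>)"
    and "1 \<le> n"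
    and "r \<le> m"
  shows "(SUP f \<in> bounded_approx_class \<nu> \<pi> f_inf K u C r \<inter> L2_densities \<nu>. risk \<nu> \<pi> m n f)
    \<le> ennreal ((C * u m)\<^sup>2 + K / real n *
        mat_trace (the (mat_inverse (gram_matrix \<nu> \<pi> m)) * Delta_matrix \<nu> \<pi> f_inf m))"
proof -
  interpret independent_pmf_family \<nu> \<pi>
    by standard fact+
  show ?thesis
    using assms by (intro SUP_least risk_le) auto
qed

end
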